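(* For $x_m>0$ and $\alpha>2$, let $X_{x_m,\alpha}$ be a Pareto random variable with parameters $x_m$ and $\alpha$, and let $Z$ be a standard normal random variable. Then, for any $x_m>0$, the quantity $$P\left\{|X_{x_m,\alpha}-E[X_{x_m,\alpha}]|\le \sqrt{\mathrm{Var}(X_{x_m,\alpha})}\right\},$$ as a function of $\alpha\in(2,\infty)$, decreases to the limit $1-e^{-2}$ as $\alpha\uparrow\infty$, and $$1-e^{-2}\approx 0.8646647>P\{|Z|\le 1\}\approx 0.6827.$$
   Context: A Pareto random variable with parameters $x_m>0$ and $\alpha>2$ has cumulative distribution function $P\{X_{x_m,\alpha}\le x\}=1-\left(\frac{x_m}{x}\right)^{\alpha}$ for $x\ge x_m$ (and $0$ for $x<x_m$). The symbol $\approx$ means equality after rounding to the number of decimals displayed. *)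

theory Defs
  imports "HOL-Probability.Probability"
begin

definition pareto_rv :: "'a measure \<Rightarrow> ('a \<Rightarrow> real) \<Rightarrow> real \<Rightarrow> real \<Rightarrow> bool" where
  "pareto_rv M X xm \<alpha> \<longleftrightarrow>
     X \<in> borel_measurable M \<and>
     (\<forall>x. \<P>(\<omega> in M. X \<omega> \<le> x) = (if x \<ge> xm then 1 - (xm / x) powr \<alpha> else 0))"

definition prob_within_one_sd :: "'a measure \<Rightarrow> ('a \<Rightarrow> real) \<Rightarrow> real" where
  "prob_within_one_sd M X =
     \<P>(\<omega> in M. \<bar>X \<omega> - prob_space.expectation M X\<bar> \<le> sqrt (prob_space.variance M X))"

text \<open>Equality after rounding to \<^term>\<open>d\<close> decimals. The digit count is explicit because
  a real number does not record how many decimals it is displayed with.\<close>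

definition approx_decimals :: "nat \<Rightarrow> real \<Rightarrow> real \<Rightarrow> bool" where
  "approx_decimals d x q \<longleftrightarrow> real_of_int (round (x * 10 ^ d)) / 10 ^ d = q"

end

theory Submission
  imports Defs "HOL-Real_Asymp.Real_Asymp"
begin

text \<open>
  For \<open>\<alpha> > 2\<close> the mean minus one standard deviation lies below \<open>x\<^sub>m\<close>, so only the upper
  bound matters, and the probability is \<open>1 - ((\<alpha> - 1) / (\<alpha> + s)) powr \<alpha>\<close> with
  \<open>s = sqrt (\<alpha> / (\<alpha> - 2))\<close>. Taking \<open>s\<close>, which decreases in \<open>\<alpha>\<close>, as the parameter, this becomes
  \<open>1 - exp (- 2 h(s) / (1 - 1/s\<^sup>2))\<close> where \<open>h\<close> is the logarithm of a rational function and both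
  \<open>h\<close> and \<open>1 - 1/s\<^sup>2\<close> vanish at \<open>s = 1\<close>. The ratio increases by the monotone form of
  l'Hospital's rule, since the ratio of the derivatives is an increasing rational function.
  The moments come from the fact that \<open>ln (X / x\<^sub>m)\<close> is exponential with rate \<open>\<alpha>\<close>.
\<close>

section \<open>Monotone form of l'Hospital's rule\<close>

text \<open>By Cauchy's mean value theorem \<open>f x / g x\<close> is a value of \<open>r\<close>
  to the left of \<open>x\<close>, and the quotient of the increments over \<open>[x, y]\<close> is
  a value of \<open>r\<close> to the right of \<open>x\<close>, hence larger. As
  \<open>f y / g y\<close> is a mediant of these two quotients, it exceeds the first.\<close>

lemma strict_mono_on_ratio:
  fixes f g g' r :: "real \<Rightarrow> real"
  assumes f: "\<And>x. a \<le> x \<Longrightarrow> (f has_real_derivative r x * g' x) (at x)"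
    and g: "\<And>x. a \<le> x \<Longrightarrow> (g has_real_derivative g' x) (at x)"
    and g': "\<And>x. a \<le> x \<Longrightarrow> g' x > 0"
    and r: "strict_mono_on {a<..} r"
    and "f a = 0" "g a = 0"
  shows "strict_mono_on {a<..} (\<lambda>x. f x / g x)"
proof (rule strict_mono_onI)
  fix x y assume "x \<in> {a<..}" "y \<in> {a<..}" "x < y"
  then have "a < x" by simp
  have mvt: "\<exists>c. u < c \<and> c < v \<and> f v - f u = r c * (g v - g u)" if "a \<le> u" "u < v" for u v
  proof -
    have "\<exists>c. u < c \<and> c < v \<and> (f v - f u) * g' c = (g v - g u) * (r c * g' c)"
      using that by (intro GMVT' f g) (auto intro!: DERIV_isCont[OF f] DERIV_isCont[OF g])
    then obtain c where c: "u < c" "c < v" "(f v - f u) * g' c = (g v - g u) * (r c * g' c)"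
      by blast
    moreover have "g' c \<noteq> 0" using g'[of c] c that by auto
    ultimately have "f v - f u = r c * (g v - g u)" by (simp add: ac_simps)
    with c show ?thesis by blast
  qed
  have g_less: "g u < g v" if "a \<le> u" "u < v" for u v
    using \<open>u < v\<close>
  proof (rule DERIV_pos_imp_increasing)
    fix z assume "u \<le> z" "z \<le> v"
    then show "\<exists>y. (g has_real_derivative y) (at z) \<and> y > 0"
      using g[of z] g'[of z] that by auto
  qed
  obtain c where c: "c < x" "a < c" "f x = r c * g x"
    using mvt[of a x] \<open>a < x\<close> \<open>f a = 0\<close> \<open>g a = 0\<close> by auto
  obtain d where d: "x < d" "f y - f x = r d * (g y - g x)"
    using mvt[of x y] \<open>a < x\<close> \<open>x < y\<close> by auto
  have "r c < r d"
    using c d \<open>a < x\<close> by (intro strict_mono_onD[OF r]) auto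
  then have "r c * (g y - g x) < r d * (g y - g x)"
    using g_less[of x y] \<open>a < x\<close> \<open>x < y\<close> by simp
  then have "r c * g y < f y"
    using c d by (simp add: algebra_simps)
  moreover have "g x > 0" "g y > 0"
    using g_less[of a x] g_less[of a y] \<open>a < x\<close> \<open>x < y\<close> \<open>g a = 0\<close> by auto
  ultimately show "f x / g x < f y / g y"
    using c by (simp add: field_simps)
qed

section \<open>Monotonicity in the parameter \<open>s\<close>\<close>

text \<open>Mean plus one standard deviation, divided by \<open>x\<^sub>m\<close>, in terms of \<open>s = pareto_sd \<alpha>\<close>.\<close>

definition sd_ratio :: "real \<Rightarrow> real" where
  "sd_ratio s = s * (s^2 + 2 * s - 1) / (s^2 + 1)"

lemma sd_ratio_pos: "s \<ge> 1 \<Longrightarrow> sd_ratio s > 0"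
  by (auto simp: sd_ratio_def intro!: divide_pos_pos mult_pos_pos add_pos_pos)
    (smt (verit) one_le_power)

text \<open>The function is the quotient of the derivatives of \<open>ln (sd_ratio s)\<close> and
  \<open>1 - 1 / s^2\<close>.\<close>

lemma strict_mono_on_derivative_ratio:
  "strict_mono_on {1<..}
     (\<lambda>s::real. s^2 * (s^4 + 4 * s^2 + 4 * s - 1) / (2 * ((s^2 + 2 * s - 1) * (s^2 + 1))))"
    (is "strict_mono_on _ ?r")
proof (rule strict_mono_onI)
  fix x y :: real assume "x \<in> {1<..}" "y \<in> {1<..}" "x < y"
  show "?r x < ?r y"
    using \<open>x < y\<close>
  proof (rule DERIV_pos_imp_increasing)
    fix z assume "x \<le> z" "z \<le> y"
    \<comment> \<open>Expanded around \<open>1\<close>, the numerator of the derivative has only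
      positive coefficients, so its sign can be read off.\<close>
    define t where "t = z - 1"
    have t: "t > 0" "z = 1 + t" using \<open>x \<le> z\<close> \<open>x \<in> _\<close> by (auto simp: t_def)
    define d where "d = 2 * ((z^2 + 2 * z - 1) * (z^2 + 1))"
    have "z^2 + 2 * z - 1 > 0" using t by (simp add: power2_eq_square algebra_simps add_pos_pos)
    then have d: "d > 0" unfolding d_def by (intro mult_pos_pos) (auto intro: add_nonneg_pos)
    have num: "2 * (32 + 208 * t + 552 * t^2 + 848 * t^3 + 888 * t^4 + 668 * t^5 + 350 * t^6 + 120 * t^7 + 24 * t^8 + 2 * t^9) =
      (6 * z^5 + 16 * z^3 + 12 * z^2 - 2 * z) * d - (z^2 * (z^4 + 4 * z^2 + 4 * z - 1)) * (2 * (4 * z^3 + 6 * z^2 + 2))"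
      unfolding t d_def by algebra
    have N: "((\<lambda>s. s^2 * (s^4 + 4 * s^2 + 4 * s - 1)) has_real_derivative 6 * z^5 + 16 * z^3 + 12 * z^2 - 2 * z) (at z)"
      by (auto intro!: derivative_eq_intros) algebra
    have D: "((\<lambda>s. 2 * ((s^2 + 2 * s - 1) * (s^2 + 1))) has_real_derivative 2 * (4 * z^3 + 6 * z^2 + 2)) (at z)"
      by (auto intro!: derivative_eq_intros) algebra
    have "(?r has_real_derivative
       ((6 * z^5 + 16 * z^3 + 12 * z^2 - 2 * z) * d - (z^2 * (z^4 + 4 * z^2 + 4 * z - 1)) * (2 * (4 * z^3 + 6 * z^2 + 2))) / (d * d)) (at z)"
      unfolding d_def using d unfolding d_def by (intro DERIV_divide N D) auto
    moreover have "2 * (32 + 208 * t + 552 * t^2 + 848 * t^3 + 888 * t^4 + 668 * t^5 + 350 * t^6 + 120 * t^7 + 24 * t^8 + 2 * t^9) / (d * d) > 0"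
      using t d by (intro divide_pos_pos mult_pos_pos add_pos_pos) auto
    ultimately show "\<exists>v. (?r has_real_derivative v) (at z) \<and> v > 0"
      unfolding num by blast
  qed
qed

text \<open>The monotone l'Hospital rule applies at \<open>a = 1\<close> because
  \<open>sd_ratio 1 = 1\<close>.\<close>

lemma strict_mono_on_ln_sd_ratio:
  "strict_mono_on {1<..} (\<lambda>s. ln (sd_ratio s) / (1 - 1 / s^2))"
proof (rule strict_mono_on_ratio[OF _ _ _ strict_mono_on_derivative_ratio])
  fix s :: real assume s: "1 \<le> s"
  have "s^2 + 2 * s - 1 > 0" using s by (smt (verit) one_le_power)
  moreover have "s^2 + 1 > 0" by (auto intro: add_nonneg_pos)
  ultimately show "((\<lambda>s. ln (sd_ratio s)) has_real_derivative
      s^2 * (s^4 + 4 * s^2 + 4 * s - 1) / (2 * ((s^2 + 2 * s - 1) * (s^2 + 1))) * (2 / s^3)) (at s)"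
    using s sd_ratio_pos[OF s] unfolding sd_ratio_def
    by (auto intro!: derivative_eq_intros) (simp add: divide_simps, algebra)
  show "((\<lambda>s. 1 - 1 / s^2) has_real_derivative 2 / s^3) (at s)"
    using s by (auto intro!: derivative_eq_intros simp: power3_eq_cube power2_eq_square)
  show "2 / s^3 > 0" using s by simp
qed (auto simp: sd_ratio_def)

section \<open>The probability as a function of \<alpha>\<close>

text \<open>The standard deviation in units of \<open>x\<^sub>m / (\<alpha> - 1)\<close>.\<close>

definition pareto_sd :: "real \<Rightarrow> real" where
  "pareto_sd \<alpha> = sqrt (\<alpha> / (\<alpha> - 2))"

text \<open>The base of the power is \<open>xm\<close> divided by the mean plus one standard
  deviation; both scale with \<open>xm\<close>, which therefore cancels.\<close>

definition pareto_within_sd :: "real \<Rightarrow> real" where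
  "pareto_within_sd \<alpha> = 1 - ((\<alpha> - 1) / (\<alpha> + pareto_sd \<alpha>)) powr \<alpha>"

lemma pareto_sd_gt_1: "\<alpha> > 2 \<Longrightarrow> pareto_sd \<alpha> > 1"
  by (simp add: pareto_sd_def)

lemma pareto_within_sd_eq:
  assumes "\<alpha> > 2"
  shows "pareto_within_sd \<alpha> = 1 - exp (- 2 * (ln (sd_ratio (pareto_sd \<alpha>)) / (1 - 1 / (pareto_sd \<alpha>)^2)))"
proof -
  define s where "s = pareto_sd \<alpha>"
  have s: "s > 1" using pareto_sd_gt_1[OF assms] by (simp add: s_def)
  have s2: "s^2 = \<alpha> / (\<alpha> - 2)" using assms by (simp add: s_def pareto_sd_def)
  have "(\<alpha> - 1) / (\<alpha> + s) = 1 / sd_ratio s"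
  proof -
    have p: "s^2 + 2 * s - 1 > 0" using s by (smt (verit) one_le_power)
    have "s^2 * (\<alpha> - 2) = \<alpha>" using s2 assms by simp
    \<comment> \<open>The left side is the cross-multiplied claim; the right side vanishes by the
      preceding equation.\<close>
    moreover have "(\<alpha> - 1) * (s * (s^2 + 2 * s - 1)) - (s^2 + 1) * (\<alpha> + s) = (s + 1) * (s^2 * (\<alpha> - 2) - \<alpha>)"
      by algebra
    ultimately have "(\<alpha> - 1) * (s * (s^2 + 2 * s - 1)) = (s^2 + 1) * (\<alpha> + s)" by simp
    then show ?thesis using s p assms by (simp add: sd_ratio_def divide_simps)
  qed
  moreover have "\<alpha> = 2 / (1 - 1 / s^2)" using assms by (simp add: s2 field_simps)
  ultimately show ?thesis using sd_ratio_pos[of s] s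
    unfolding pareto_within_sd_def s_def[symmetric] powr_def
    by (simp add: ln_div)
qed

lemma strict_antimono_on_pareto_within_sd: "strict_antimono_on {2<..} pareto_within_sd"
proof (rule monotone_onI)
  fix a b :: real assume ab: "a \<in> {2<..}" "b \<in> {2<..}" "a < b"
  then have "pareto_sd b < pareto_sd a"
    by (simp add: pareto_sd_def divide_simps) (simp add: algebra_simps)
  with ab have "ln (sd_ratio (pareto_sd b)) / (1 - 1 / (pareto_sd b)^2) < ln (sd_ratio (pareto_sd a)) / (1 - 1 / (pareto_sd a)^2)"
    by (intro strict_mono_onD[OF strict_mono_on_ln_sd_ratio]) (auto simp: pareto_sd_gt_1)
  with ab show "pareto_within_sd b < pareto_within_sd a"
    by (simp add: pareto_within_sd_eq)
qed

text \<open>With \<open>s = pareto_sd \<alpha>\<close> tending to \<open>1\<close>, the base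
  \<open>1 - (1 + s) / (\<alpha> + s)\<close> behaves like \<open>1 - 2 / \<alpha>\<close>.\<close>

lemma pareto_within_sd_tendsto: "(pareto_within_sd \<longlongrightarrow> 1 - exp (-2)) at_top"
  unfolding pareto_within_sd_def pareto_sd_def by real_asymp

section \<open>Moments of the Pareto distribution\<close>

text \<open>The distribution function vanishes at \<open>xm\<close> itself, since
  \<open>(xm / xm) powr \<alpha> = 1\<close>; this excludes equality too.\<close>

lemma pareto_rv_AE_gt:
  assumes "prob_space M" "pareto_rv M X xm \<alpha>" "xm > 0"
  shows "AE \<omega> in M. X \<omega> > xm"
proof -
  interpret prob_space M by fact
  have [measurable]: "X \<in> borel_measurable M" using assms by (simp add: pareto_rv_def)
  have "\<P>(\<omega> in M. X \<omega> \<le> xm) = 0" using assms by (simp add: pareto_rv_def)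
  then have "AE \<omega> in M. \<not> X \<omega> \<le> xm" by (subst (asm) prob_Collect_eq_0) auto
  then show ?thesis by (simp add: not_le)
qed

text \<open>Exponential laws are characterised by their distribution function on
  \<open>a \<ge> 0\<close>, so the logarithm leads from the Pareto distribution function to a
  density.\<close>

lemma pareto_rv_ln_exponential:
  assumes "prob_space M" "pareto_rv M X xm \<alpha>" "xm > 0" "\<alpha> > 0"
  shows "distributed M lborel (\<lambda>\<omega>. ln (X \<omega> / xm)) (exponential_density \<alpha>)"
proof -
  interpret prob_space M by fact
  have [measurable]: "X \<in> borel_measurable M" using assms by (simp add: pareto_rv_def)
  have "\<P>(\<omega> in M. ln (X \<omega> / xm) \<le> a) = 1 - exp (- a * \<alpha>)" if "a \<ge> 0" for a
  proof -
    have "\<P>(\<omega> in M. ln (X \<omega> / xm) \<le> a) = \<P>(\<omega> in M. X \<omega> \<le> xm * exp a)"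
    \<comment> \<open>The events are compared almost everywhere, because \<open>exp\<close> inverts
      \<open>ln\<close> only where \<open>X \<omega> / xm > 0\<close>.\<close>
    proof (rule finite_measure_eq_AE)
      show "AE \<omega> in M. (\<omega> \<in> {\<omega> \<in> space M. ln (X \<omega> / xm) \<le> a}) = (\<omega> \<in> {\<omega> \<in> space M. X \<omega> \<le> xm * exp a})"
        using pareto_rv_AE_gt[OF assms(1-3)]
      proof eventually_elim
        case (elim \<omega>)
        then have "X \<omega> / xm > 0" using \<open>xm > 0\<close> by simp
        then have "ln (X \<omega> / xm) \<le> a \<longleftrightarrow> X \<omega> / xm \<le> exp a"
          by (metis exp_le_cancel_iff exp_ln)
        then show ?case using \<open>xm > 0\<close> by (simp add: field_simps)
      qed
    qed measurable
    also have "\<dots> = 1 - (xm / (xm * exp a)) powr \<alpha>"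
      using assms that by (simp add: pareto_rv_def)
    also have "(xm / (xm * exp a)) powr \<alpha> = exp (- a * \<alpha>)"
      using assms by (simp add: powr_def ln_div)
    finally show ?thesis .
  qed
  then show ?thesis using assms by (simp add: exponential_distributed_iff)
qed

text \<open>With \<open>X = xm * exp Y\<close>, the factor \<open>exp (k * x)\<close> tilts the
  exponential density of rate \<open>\<alpha>\<close> into \<open>\<alpha> / (\<alpha> - k)\<close>
  times that of rate \<open>\<alpha> - k\<close>.\<close>

lemma pareto_rv_moment:
  assumes "prob_space M" "pareto_rv M X xm \<alpha>" "xm > 0" "\<alpha> > real k"
  shows "has_bochner_integral M (\<lambda>\<omega>. X \<omega> ^ k) (\<alpha> * xm ^ k / (\<alpha> - k))"
proof -
  interpret prob_space M by fact
  define Y where "Y = (\<lambda>\<omega>. ln (X \<omega> / xm))"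
  have \<alpha>: "\<alpha> > 0" using assms(4) of_nat_0_le_iff[of k] by linarith
  have D: "distributed M lborel Y (exponential_density \<alpha>)"
    unfolding Y_def using assms \<alpha> by (intro pareto_rv_ln_exponential)
  have [measurable]: "X \<in> borel_measurable M" using assms by (simp add: pareto_rv_def)
  \<comment> \<open>The total mass \<open>1\<close> of the tilted density comes from its defining a
    probability space.\<close>
  interpret E: prob_space "density lborel (exponential_density (\<alpha> - k))"
    using assms by (intro prob_space_exponential_density) simp
  have pos: "AE x in lborel. 0 \<le> exponential_density (\<alpha> - k) x"
    using assms by (intro AE_I2 exponential_density_nonneg) simp
  have "integrable lborel (exponential_density (\<alpha> - k))"
    using E.integrable_const[of "1 :: real"] pos by (subst (asm) integrable_density) auto
  moreover have "(\<integral>x. exponential_density (\<alpha> - k) x \<partial>lborel)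
      = (\<integral>x. 1 \<partial>density lborel (exponential_density (\<alpha> - k)))"
    using pos by (subst integral_density) auto
  ultimately have "has_bochner_integral lborel (exponential_density (\<alpha> - k)) 1"
    using E.prob_space by (simp add: has_bochner_integral_iff)
  from has_bochner_integral_mult_right[OF this, of "\<alpha> * xm ^ k / (\<alpha> - k)"]
  have "has_bochner_integral lborel
      (\<lambda>x. \<alpha> * xm ^ k / (\<alpha> - k) * exponential_density (\<alpha> - k) x) (\<alpha> * xm ^ k / (\<alpha> - k))"
    by simp
  moreover have "\<alpha> * xm ^ k / (\<alpha> - k) * exponential_density (\<alpha> - k) x
      = exponential_density \<alpha> x * (xm * exp x) ^ k" for x
  proof -
    have "exp (- x * (\<alpha> - k)) = exp (- x * \<alpha>) * exp x ^ k"
      by (simp add: exp_of_nat_mult[symmetric] exp_add[symmetric] algebra_simps)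
    then show ?thesis
      using assms by (simp add: exponential_density_def power_mult_distrib)
  qed
  ultimately have "has_bochner_integral lborel (\<lambda>x. exponential_density \<alpha> x * (xm * exp x) ^ k) (\<alpha> * xm ^ k / (\<alpha> - k))"
    by simp
  then have "has_bochner_integral M (\<lambda>\<omega>. (xm * exp (Y \<omega>)) ^ k) (\<alpha> * xm ^ k / (\<alpha> - k))"
    using distributed_integral[OF D, of "\<lambda>x. (xm * exp x) ^ k"]
      distributed_integrable[OF D, of "\<lambda>x. (xm * exp x) ^ k"] \<alpha>
    by (simp add: has_bochner_integral_iff exponential_density_nonneg)
  moreover have "AE \<omega> in M. (xm * exp (Y \<omega>)) ^ k = X \<omega> ^ k"
    using pareto_rv_AE_gt[OF assms(1-3)] \<open>xm > 0\<close> by (auto simp: Y_def)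
  ultimately show ?thesis
    by (subst has_bochner_integral_cong_AE[symmetric, where f = "\<lambda>\<omega>. (xm * exp (Y \<omega>)) ^ k"])
     (auto simp: Y_def)
qed

lemma
  assumes "prob_space M" "pareto_rv M X xm \<alpha>" "xm > 0" "\<alpha> > 2"
  shows pareto_rv_expectation: "prob_space.expectation M X = \<alpha> * xm / (\<alpha> - 1)"
    and pareto_rv_variance: "prob_space.variance M X = (xm / (\<alpha> - 1))^2 * (\<alpha> / (\<alpha> - 2))"
proof -
  interpret prob_space M by fact
  have 1: "has_bochner_integral M X (\<alpha> * xm / (\<alpha> - 1))"
    using pareto_rv_moment[OF assms(1-3), of 1] assms by simp
  have 2: "has_bochner_integral M (\<lambda>\<omega>. (X \<omega>)^2) (\<alpha> * xm^2 / (\<alpha> - 2))"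
    using pareto_rv_moment[OF assms(1-3), of 2] assms by simp
  show "expectation X = \<alpha> * xm / (\<alpha> - 1)" using 1 by (simp add: has_bochner_integral_iff)
  show "variance X = (xm / (\<alpha> - 1))^2 * (\<alpha> / (\<alpha> - 2))"
    using 1 2 assms
    by (subst variance_eq) (auto simp: has_bochner_integral_iff divide_simps, algebra)
qed

section \<open>The probability of lying within one standard deviation\<close>

lemma prob_within_one_sd_pareto:
  assumes "prob_space M" "pareto_rv M X xm \<alpha>" "xm > 0" "\<alpha> > 2"
  shows "prob_within_one_sd M X = pareto_within_sd \<alpha>"
proof -
  interpret prob_space M by fact
  have [measurable]: "X \<in> borel_measurable M" using assms by (simp add: pareto_rv_def)
  define s where "s = pareto_sd \<alpha>"
  \<comment> \<open>In the unit \<open>u\<close> the mean is \<open>\<alpha>\<close>, the standard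
    deviation \<open>s\<close> and the left endpoint \<open>\<alpha> - 1\<close>.\<close>
  define u where "u = xm / (\<alpha> - 1)"
  have s: "s > 1" using pareto_sd_gt_1 assms by (simp add: s_def)
  have u: "u > 0" and xm: "xm = u * (\<alpha> - 1)" using assms by (simp_all add: u_def)
  \<comment> \<open>Hence \<open>u * \<alpha> - u * s < xm\<close>, so the lower bound on
    \<open>X\<close> holds almost surely.\<close>
  have "u < u * s" using u s by simp
  have *: "sqrt (variance X) = u * s" "expectation X = u * \<alpha>"
    unfolding pareto_rv_variance[OF assms] unfolding pareto_rv_expectation[OF assms] u_def s_def pareto_sd_def
    using assms by (simp_all only: real_sqrt_mult real_sqrt_abs) auto
  have "prob_within_one_sd M X = \<P>(\<omega> in M. X \<omega> \<le> u * (\<alpha> + s))"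
    unfolding prob_within_one_sd_def *(1) unfolding *(2)
  proof (rule finite_measure_eq_AE)
    show "AE \<omega> in M. (\<omega> \<in> {\<omega> \<in> space M. \<bar>X \<omega> - u * \<alpha>\<bar> \<le> u * s}) = (\<omega> \<in> {\<omega> \<in> space M. X \<omega> \<le> u * (\<alpha> + s)})"
      using pareto_rv_AE_gt[OF assms(1-3)]
    proof eventually_elim
      case (elim \<omega>)
      then show ?case using \<open>u < u * s\<close> by (auto simp: xm algebra_simps abs_le_iff)
    qed
  qed measurable
  also have "\<dots> = 1 - (xm / (u * (\<alpha> + s))) powr \<alpha>"
  proof -
    have "xm \<le> u * (\<alpha> + s)" unfolding xm using u s by (intro mult_left_mono) auto
    then show ?thesis using assms by (simp add: pareto_rv_def)
  qed
  also have "xm / (u * (\<alpha> + s)) = (\<alpha> - 1) / (\<alpha> + s)"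
    using u by (simp add: xm)
  finally show ?thesis by (simp add: s_def pareto_within_sd_def)
qed

section \<open>Numerical bounds for \<open>exp (- 2)\<close> and \<open>pi\<close>\<close>

text \<open>The Lagrange remainder is a positive multiple of \<open>(- x) ^ n\<close>, which is
  nonnegative for even \<open>n\<close>.\<close>

lemma exp_minus_ge_Taylor:
  fixes x :: real
  assumes "even n"
  shows "(\<Sum>m<n. (- x) ^ m / fact m) \<le> exp (- x)"
  using Maclaurin_exp_le[of "- x" n] assms by (auto intro!: divide_nonneg_pos)

lemma exp_minus_le_Taylor:
  fixes x :: real
  assumes "odd n" "x \<ge> 0"
  shows "exp (- x) \<le> (\<Sum>m<n. (- x) ^ m / fact m)"
proof -
  obtain t where "exp (- x) = (\<Sum>m<n. (- x) ^ m / fact m) + (exp t / fact n) * (- x) ^ n"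
    using Maclaurin_exp_le[of "- x" n] by auto
  moreover have "(exp t / fact n) * (- x) ^ n \<le> 0"
    using assms by (simp add: mult_nonneg_nonneg)
  ultimately show ?thesis by linarith
qed

lemma exp_minus_2_bounds: "exp (- 2 :: real) \<in> {0.13533528..0.13533529}"
proof -
  \<comment> \<open>The two sums differ by \<open>2 ^ 16 / fact 16\<close>, about
    \<open>3e-9\<close>, which fits into an interval of width \<open>1e-8\<close>.\<close>
  have "(\<Sum>m<16. (- 2) ^ m / fact m) \<le> exp (- 2 :: real)" "exp (- 2 :: real) \<le> (\<Sum>m<17. (- 2) ^ m / fact m)"
    by (intro exp_minus_ge_Taylor exp_minus_le_Taylor; simp)+
  then show ?thesis
    by (simp add: eval_nat_numeral lessThan_Suc fact_numeral)
qed

text \<open>The derivative \<open>1 / (1 + t^2)\<close> is a geometric series in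
  \<open>- t^2\<close>; cutting it after four terms leaves the remainder
  \<open>t^8 / (1 + t^2)\<close>.\<close>

lemma arctan_ge_Taylor:
  assumes "x \<ge> 0"
  shows "x - x^3 / 3 + x^5 / 5 - x^7 / 7 \<le> arctan x"
proof -
  have "arctan 0 - (0 - 0^3 / 3 + 0^5 / 5 - 0^7 / 7) \<le> arctan x - (x - x^3 / 3 + x^5 / 5 - x^7 / 7)"
  proof (rule DERIV_nonneg_imp_nondecreasing[OF assms])
    fix t :: real
    have "1 + t^2 > 0" by (auto intro: add_pos_nonneg)
    then have "((\<lambda>x. arctan x - (x - x^3 / 3 + x^5 / 5 - x^7 / 7)) has_real_derivative t^8 / (1 + t^2)) (at t)"
      by (auto intro!: derivative_eq_intros simp: field_simps)
    then show "\<exists>y. ((\<lambda>x. arctan x - (x - x^3 / 3 + x^5 / 5 - x^7 / 7)) has_real_derivative y) (at t) \<and> 0 \<le> y"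
      by (intro exI conjI) auto
  qed
  then show ?thesis by simp
qed

lemma arctan_le_Taylor:
  assumes "x \<ge> 0"
  shows "arctan x \<le> x - x^3 / 3 + x^5 / 5"
proof -
  have "0 - 0^3 / 3 + 0^5 / 5 - arctan 0 \<le> x - x^3 / 3 + x^5 / 5 - arctan x"
  proof (rule DERIV_nonneg_imp_nondecreasing[OF assms])
    fix t :: real
    have "1 + t^2 > 0" by (auto intro: add_pos_nonneg)
    then have "((\<lambda>x. x - x^3 / 3 + x^5 / 5 - arctan x) has_real_derivative t^6 / (1 + t^2)) (at t)"
      by (auto intro!: derivative_eq_intros simp: field_simps)
    then show "\<exists>y. ((\<lambda>x. x - x^3 / 3 + x^5 / 5 - arctan x) has_real_derivative y) (at t) \<and> 0 \<le> y"
      by (intro exI conjI) auto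
  qed
  then show ?thesis by simp
qed

text \<open>Machin's formula \<open>pi / 4 = 4 * arctan (1/5) - arctan (1/239)\<close>: each bound
  on \<open>pi\<close> pairs opposite bounds on the two arctangents.\<close>

lemma pi_bounds: "pi \<in> {3.14155..3.14163}"
  using machin arctan_ge_Taylor[of "1/5"] arctan_le_Taylor[of "1/5"]
    arctan_ge_Taylor[of "1/239"] arctan_le_Taylor[of "1/239"]
  by (simp add: power_divide)

section \<open>The standard normal probability\<close>

lemma integral_Taylor_gaussian:
  "(\<integral>x. indicator {-1..1::real} x *\<^sub>R (\<Sum>m<n. (- (x^2 / 2)) ^ m / fact m) \<partial>lborel)
    = 2 * (\<Sum>m<n. (- 1 / 2) ^ m / (fact m * (2 * real m + 1)))"
proof -
  \<comment> \<open>\<open>F\<close> is the termwise antiderivative; it is odd, which gives the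
    factor \<open>2\<close> in the result.\<close>
  define F where "F x = (\<Sum>m<n. (- 1 / 2) ^ m / (fact m * (2 * real m + 1)) * x ^ (2 * m + 1))" for x :: real
  have "(\<integral>x. indicator {-1..1::real} x *\<^sub>R (\<Sum>m<n. (- (x^2 / 2)) ^ m / fact m) \<partial>lborel) = F 1 - F (-1)"
  proof (rule integral_FTC_atLeastAtMost)
    fix x :: real
    have "(F has_real_derivative (\<Sum>m<n. (- 1 / 2) ^ m / (fact m * (2 * real m + 1)) * ((2 * real m + 1) * x ^ (2 * m)))) (at x)"
      unfolding F_def
      by (intro DERIV_sum DERIV_cmult) (use DERIV_pow[of "2 * m + 1" x for m] in \<open>simp add: add.commute\<close>)
    also have "(\<Sum>m<n. (- 1 / 2) ^ m / (fact m * (2 * real m + 1)) * ((2 * real m + 1) * x ^ (2 * m)))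
        = (\<Sum>m<n. (- (x^2 / 2)) ^ m / fact m)"
    proof (rule sum.cong[OF refl])
      fix m
      have "(- (x^2 / 2)) ^ m = (- 1 / 2) ^ m * x ^ (2 * m)"
        by (simp add: power_mult power_mult_distrib[symmetric])
      moreover have "u / (fact m * c) * (c * v) = u * v / fact m" if "c \<noteq> 0" for u c v :: real
        using that by simp
      moreover have "2 * real m + 1 \<noteq> 0" by linarith
      ultimately show "(- 1 / 2) ^ m / (fact m * (2 * real m + 1)) * ((2 * real m + 1) * x ^ (2 * m)) = (- (x^2 / 2)) ^ m / fact m"
        by metis
    qed
    finally show "(F has_vector_derivative (\<Sum>m<n. (- (x^2 / 2)) ^ m / fact m)) (at x within {-1..1})"
      by (simp add: has_real_derivative_iff_has_vector_derivative has_vector_derivative_at_within)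
  qed (auto intro!: continuous_intros)
  then show ?thesis by (simp add: F_def sum_negf)
qed

lemma std_normal_prob_bounds:
  assumes "distributed N lborel Z std_normal_density"
  shows "\<P>(\<omega> in N. \<bar>Z \<omega>\<bar> \<le> 1) \<in> {0.68266..0.68274}"
proof -
  define p where "p = \<P>(\<omega> in N. \<bar>Z \<omega>\<bar> \<le> 1)"
  define I where "I = (\<integral>x. indicator {-1..1::real} x *\<^sub>R exp (- (x^2 / 2)) \<partial>lborel)"
  have int: "integrable lborel (\<lambda>x. indicator {-1..1::real} x *\<^sub>R f x)" if "continuous_on {-1..1} f" for f :: "real \<Rightarrow> real"
    using borel_integrable_atLeastAtMost'[OF that] by (simp add: set_integrable_def)
  have [measurable]: "Z \<in> borel_measurable N" using distributed_measurable[OF assms] by simp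
  have "I / sqrt (2 * pi) = (\<integral>x. std_normal_density x * indicator {-1..1} x \<partial>lborel)"
    unfolding I_def integral_divide_zero[symmetric]
    by (intro Bochner_Integration.integral_cong) (auto simp: std_normal_density_def)
  also have "\<dots> = (\<integral>\<omega>. indicator {-1..1} (Z \<omega>) \<partial>N)"
    by (rule distributed_integral[OF assms]) auto
  also have "\<dots> = (\<integral>\<omega>. indicator {\<omega> \<in> space N. \<bar>Z \<omega>\<bar> \<le> 1} \<omega> \<partial>N)"
    by (intro Bochner_Integration.integral_cong) (auto simp: indicator_def)
  also have "\<dots> = p" by (simp add: p_def)
  finally have p: "p = I / sqrt (2 * pi)" ..
  \<comment> \<open>An even number of terms bounds the exponential from below and an odd number from
    above; six and five already fix \<open>I\<close> to within \<open>5e-5\<close>.\<close>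
  have "(\<integral>x. indicator {-1..1} x *\<^sub>R (\<Sum>m<6. (- (x^2 / 2)) ^ m / fact m) \<partial>lborel) \<le> I"
    unfolding I_def
    by (intro integral_mono int continuous_intros)
      (auto simp: indicator_def intro: exp_minus_ge_Taylor)
  moreover have "I \<le> (\<integral>x. indicator {-1..1} x *\<^sub>R (\<Sum>m<5. (- (x^2 / 2)) ^ m / fact m) \<partial>lborel)"
    unfolding I_def
    by (intro integral_mono int continuous_intros)
      (auto simp: indicator_def intro: exp_minus_le_Taylor)
  ultimately have I: "I \<in> {1.71124..1.71131}"
    unfolding integral_Taylor_gaussian by (simp add: eval_nat_numeral lessThan_Suc fact_numeral)
  have "2.50661 \<le> sqrt (2 * pi)"
    by (rule real_le_rsqrt) (use pi_bounds in \<open>simp add: power2_eq_square\<close>)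
  moreover have "sqrt (2 * pi) \<le> 2.50666"
    by (rule real_le_lsqrt) (use pi_bounds in \<open>simp_all add: power2_eq_square\<close>)
  ultimately show ?thesis
    using I unfolding p_def[symmetric] p by (simp add: field_simps)
qed

text \<open>A distance strictly below one half determines the rounded integer without recourse to a
  tie rule.\<close>

lemma approx_decimalsI:
  assumes "\<bar>x * 10 ^ d - of_int n\<bar> < 1 / 2" "q = of_int n / 10 ^ d"
  shows "approx_decimals d x q"
  using round_unique'[OF assms(1)] assms(2) by (simp add: approx_decimals_def)

theorem theorem2p4:
  fixes M :: "real \<Rightarrow> 'a measure" and X :: "real \<Rightarrow> 'a \<Rightarrow> real" and xm :: real
    and N :: "'b measure" and Z :: "'b \<Rightarrow> real"
  assumes "xm > 0"
    and "\<And>\<alpha>. \<alpha> > 2 \<Longrightarrow> prob_space (M \<alpha>)"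
    and "\<And>\<alpha>. \<alpha> > 2 \<Longrightarrow> pareto_rv (M \<alpha>) (X \<alpha>) xm \<alpha>"
    and "prob_space N"
    and "distributed N lborel Z std_normal_density"
  shows "strict_antimono_on {2<..} (\<lambda>\<alpha>. prob_within_one_sd (M \<alpha>) (X \<alpha>))
    \<and> ((\<lambda>\<alpha>. prob_within_one_sd (M \<alpha>) (X \<alpha>)) \<longlongrightarrow> 1 - exp (-2)) at_top
    \<and> approx_decimals 7 (1 - exp (-2)) 0.8646647
    \<and> 0.8646647 > \<P>(\<omega> in N. \<bar>Z \<omega>\<bar> \<le> 1)
    \<and> 1 - exp (-2) > \<P>(\<omega> in N. \<bar>Z \<omega>\<bar> \<le> 1)
    \<and> approx_decimals 4 (\<P>(\<omega> in N. \<bar>Z \<omega>\<bar> \<le> 1)) 0.6827"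
proof -
  define p where "p = \<P>(\<omega> in N. \<bar>Z \<omega>\<bar> \<le> 1)"
  have p: "p \<in> {0.68266..0.68274}"
    using std_normal_prob_bounds[OF assms(5)] by (simp add: p_def)
  \<comment> \<open>The value depends on \<alpha> alone, so the spaces \<open>M \<alpha>\<close> may
    be unrelated to each other.\<close>
  have eq: "prob_within_one_sd (M \<alpha>) (X \<alpha>) = pareto_within_sd \<alpha>" if "\<alpha> > 2" for \<alpha>
    using assms that by (intro prob_within_one_sd_pareto)
  have "strict_antimono_on {2<..} (\<lambda>\<alpha>. prob_within_one_sd (M \<alpha>) (X \<alpha>))"
    using strict_antimono_on_pareto_within_sd by (simp add: monotone_on_def eq)
  moreover have "((\<lambda>\<alpha>. prob_within_one_sd (M \<alpha>) (X \<alpha>)) \<longlongrightarrow> 1 - exp (-2)) at_top"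
  proof (rule Lim_transform_eventually[OF pareto_within_sd_tendsto])
    show "\<forall>\<^sub>F \<alpha> in at_top. pareto_within_sd \<alpha> = prob_within_one_sd (M \<alpha>) (X \<alpha>)"
      \<comment> \<open>The closed form is available only for \<open>\<alpha> > 2\<close>, which
        suffices at infinity.\<close>
      using eventually_gt_at_top[of "2 :: real"] by eventually_elim (simp add: eq)
  qed
  moreover have "approx_decimals 7 (1 - exp (-2)) 0.8646647"
    using exp_minus_2_bounds by (intro approx_decimalsI[of _ _ 8646647]) auto
  moreover have "approx_decimals 4 p 0.6827"
    using p by (intro approx_decimalsI[of _ _ 6827]) (auto simp: abs_if)
  moreover have "0.8646647 > p" "1 - exp (-2) > p"
    using exp_minus_2_bounds p by auto
  ultimately show ?thesis unfolding p_def by blast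
qed

end
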